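(* Let $\alpha\in\mathbb{R}\setminus\mathbb{Q}$, let $(q_\ell)_{\ell\ge 0}$ be the sequence of denominators of the principal convergents of $\alpha$, and let $N\in\mathbb{N}$ and $\varepsilon>0$ be such that $N^{-1}<2\varepsilon<\|q_2\alpha\|$. Let $K$ be the largest non-negative integer such that $q_K\le N$, and let $$M:=\max\Big\{\varepsilon N,\ \min\Big\{\varepsilon q_{K+1},\frac{N}{2q_K}\Big\}\Big\}=\min\Big\{\varepsilon q_{K+1},\ \max\Big\{\varepsilon N,\frac{N}{2q_K}\Big\}\Big\}.$$ Then $$\lfloor M\rfloor\ \le\ \#\{n\in\mathbb{N}:\|n\alpha\|<\varepsilon,\ n\le N\}\ \le\ 32M.$$
   Context: $\|x\|$ denotes the distance from $x\in\mathbb{R}$ to the nearest integer. For irrational $\alpha=[a_0;a_1,a_2,\dots]$ (simple continued fraction expansion), $q_\ell$ is the denominator of $[a_0;a_1,\dots,a_\ell]$ in lowest terms (so $q_0=1$, $q_1=a_1$, $q_{\ell+1}=a_{\ell+1}q_\ell+q_{\ell-1}$). *)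

theory Defs
  imports Complex_Main
begin

definition dist_int :: "real \<Rightarrow> real" where
  "dist_int x = \<bar>x - of_int (round x)\<bar>"

lemma dist_int_le: "dist_int x \<le> \<bar>x - of_int m\<bar>"
  unfolding dist_int_def by (metis round_diff_minimal)

(* Complete quotients of the continued fraction algorithm. For rational x the recursion
   eventually runs through 1 / 0 = 0 and is meaningless; it is used for irrational x only. *)
primrec cf_quotient :: "real \<Rightarrow> nat \<Rightarrow> real" where
  "cf_quotient x 0 = x"
| "cf_quotient x (Suc n) = 1 / frac (cf_quotient x n)"

definition cf_coeff :: "real \<Rightarrow> nat \<Rightarrow> int" where
  "cf_coeff x n = \<lfloor>cf_quotient x n\<rfloor>"

(* cf_value a n = [a 0; a 1, ..., a n] *)
primrec cf_value :: "(nat \<Rightarrow> int) \<Rightarrow> nat \<Rightarrow> rat" where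
  "cf_value a 0 = of_int (a 0)"
| "cf_value a (Suc n) = of_int (a 0) + 1 / cf_value (\<lambda>i. a (Suc i)) n"

(* quotient_of yields lowest terms with a positive denominator *)
definition cf_denom :: "real \<Rightarrow> nat \<Rightarrow> nat" where
  "cf_denom x n = nat (snd (quotient_of (cf_value (cf_coeff x) n)))"


lemma cf_quotient_irrational:
  assumes "x \<notin> \<rat>"
  shows "cf_quotient x n \<notin> \<rat>"
proof (induction n)
  case 0
  then show ?case using assms by simp
next
  case (Suc n)
  have "frac (cf_quotient x n) \<in> \<rat>" if "1 / frac (cf_quotient x n) \<in> \<rat>"
    using Rats_inverse[OF that] by (simp add: inverse_eq_divide)
  moreover have "cf_quotient x n = frac (cf_quotient x n) + of_int \<lfloor>cf_quotient x n\<rfloor>"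
    by (simp add: frac_def)
  ultimately show ?case
    using Suc by (metis Rats_add Rats_of_int cf_quotient.simps(2))
qed

lemma cf_coeff_pos:
  assumes "x \<notin> \<rat>"
  shows "cf_coeff x (Suc n) \<ge> 1"
proof -
  have "cf_quotient x n \<notin> \<int>"
    using cf_quotient_irrational[OF assms, of n] Ints_subset_Rats by blast
  then have "frac (cf_quotient x n) > 0" by (simp add: frac_gt_0_iff)
  moreover have "frac (cf_quotient x n) < 1" by (simp add: frac_lt_1)
  ultimately have "1 / frac (cf_quotient x n) \<ge> 1" by simp
  then show ?thesis by (simp add: cf_coeff_def le_floor_iff)
qed

(* Numerator and denominator of cf_value as integer polynomials in the coefficients. *)
primrec cf_pair :: "(nat \<Rightarrow> int) \<Rightarrow> nat \<Rightarrow> int \<times> int" where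
  "cf_pair a 0 = (a 0, 1)"
| "cf_pair a (Suc n) = (let (h, k) = cf_pair (\<lambda>i. a (Suc i)) n in (a 0 * h + k, h))"

lemma cf_pair_rec:
  "fst (cf_pair a (Suc (Suc n))) = a (Suc (Suc n)) * fst (cf_pair a (Suc n)) + fst (cf_pair a n)"
  "snd (cf_pair a (Suc (Suc n))) = a (Suc (Suc n)) * snd (cf_pair a (Suc n)) + snd (cf_pair a n)"
proof (induction n arbitrary: a)
  case 0
  { case 1 show ?case by (simp add: algebra_simps) }
  { case 2 show ?case by simp }
next
  case (Suc n)
  have fst_Suc: "fst (cf_pair a (Suc m)) =
      a 0 * fst (cf_pair (\<lambda>i. a (Suc i)) m) + snd (cf_pair (\<lambda>i. a (Suc i)) m)"
    and snd_Suc: "snd (cf_pair a (Suc m)) = fst (cf_pair (\<lambda>i. a (Suc i)) m)" for a m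
    by (simp_all add: case_prod_unfold Let_def)
  note IH = Suc.IH[of "\<lambda>i. a (Suc i)" for a]
  { case 1 show ?case
      unfolding fst_Suc[of a "Suc (Suc n)"] fst_Suc[of a "Suc n"] fst_Suc[of a n] unfolding IH
      by (simp only: algebra_simps) }
  { case 2 show ?case
      unfolding snd_Suc[of a "Suc (Suc n)"] snd_Suc[of a "Suc n"] snd_Suc[of a n] unfolding IH
      by (rule refl) }
qed

lemma cf_pair_pos:
  assumes "\<And>i. a i \<ge> 1"
  shows "fst (cf_pair a n) > 0 \<and> snd (cf_pair a n) > 0"
  using assms
proof (induction n arbitrary: a)
  case 0
  have "a 0 \<ge> 1" by (rule 0)
  then show ?case by simp
next
  case (Suc n)
  have "fst (cf_pair (\<lambda>i. a (Suc i)) n) > 0 \<and> snd (cf_pair (\<lambda>i. a (Suc i)) n) > 0"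
    by (rule Suc.IH) (rule Suc.prems)
  moreover have "a 0 \<ge> 1" by (rule Suc.prems)
  ultimately show ?case
    by (auto simp: case_prod_unfold Let_def intro!: add_pos_pos mult_pos_pos)
qed

lemma cf_pair_coprime: "coprime (fst (cf_pair a n)) (snd (cf_pair a n))"
proof (induction n arbitrary: a)
  case 0
  then show ?case by simp
next
  case (Suc n)
  have "gcd (a 0 * h + k) h = gcd k h" for h k :: int
    by (metis add.commute gcd.commute gcd_add_mult)
  then show ?case using Suc[of "\<lambda>i. a (Suc i)"]
    by (simp add: case_prod_unfold Let_def coprime_iff_gcd_eq_1 gcd.commute)
qed

lemma cf_value_eq_pair:
  assumes "\<And>i. a (Suc i) \<ge> 1"
  shows "snd (cf_pair a n) > 0 \<and>
    cf_value a n = of_int (fst (cf_pair a n)) / of_int (snd (cf_pair a n))"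
  using assms
proof (induction n arbitrary: a)
  case 0
  then show ?case by simp
next
  case (Suc n)
  have "fst (cf_pair (\<lambda>i. a (Suc i)) n) > 0"
    by (rule conjunct1[OF cf_pair_pos]) (rule Suc.prems)
  moreover have "cf_value (\<lambda>i. a (Suc i)) n =
      of_int (fst (cf_pair (\<lambda>i. a (Suc i)) n)) / of_int (snd (cf_pair (\<lambda>i. a (Suc i)) n))"
    by (rule conjunct2[OF Suc.IH]) (rule Suc.prems)
  ultimately show ?case
    by (simp add: case_prod_unfold Let_def field_simps)
qed

lemma cf_denom_eq_pair:
  assumes "x \<notin> \<rat>"
  shows "int (cf_denom x n) = snd (cf_pair (cf_coeff x) n)"
proof -
  let ?p = "cf_pair (cf_coeff x) n"
  have *: "snd ?p > 0" "cf_value (cf_coeff x) n = of_int (fst ?p) / of_int (snd ?p)"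
    using cf_value_eq_pair[of "cf_coeff x" n, OF cf_coeff_pos[OF assms]] by auto
  have "quotient_of (cf_value (cf_coeff x) n) = ?p"
    using * cf_pair_coprime[of "cf_coeff x" n] normalize_stable[of "snd ?p" "fst ?p"]
    by (simp add: Fract_of_int_quotient[symmetric] quotient_of_Fract)
  then show ?thesis using * by (simp add: cf_denom_def)
qed

lemma cf_denom_0: "cf_denom x 0 = 1"
  by (simp add: cf_denom_def)

lemma cf_denom_1: "x \<notin> \<rat> \<Longrightarrow> int (cf_denom x 1) = cf_coeff x 1"
  by (simp add: cf_denom_eq_pair)

lemma cf_denom_rec:
  "x \<notin> \<rat> \<Longrightarrow> int (cf_denom x (Suc (Suc n))) =
    cf_coeff x (Suc (Suc n)) * int (cf_denom x (Suc n)) + int (cf_denom x n)"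
  by (simp add: cf_denom_eq_pair cf_pair_rec del: cf_pair.simps)

end

theory Submission
  imports Defs
begin

text \<open>
  Write \<open>q = q\<^sub>K\<close>, \<open>q' = q\<^bsub>K+1\<^esub>\<close>, so that \<open>q \<le> N < q'\<close>, and let \<open>A\<close> be the set of
  \<open>n \<le> N\<close> with \<open>\<parallel>n\<alpha>\<parallel> < \<epsilon>\<close>. The equality of the two expressions for \<open>M\<close> is the modular law
  for \<open>min\<close> and \<open>max\<close>, since \<open>\<epsilon>N \<le> \<epsilon>q'\<close>.

  The arithmetic input is that denominators of convergents are times of best approximation:
  \<open>\<parallel>n\<alpha>\<parallel> \<ge> 1 / (2 q\<^sub>k)\<close> whenever \<open>0 < n < q\<^sub>k\<close> (\<open>dist_int_ge_below_denom\<close>). Hence the points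
  \<open>n\<alpha>\<close> modulo 1, with \<open>n\<close> in a window of at most \<open>q\<^sub>k\<close> consecutive integers, are
  \<open>1 / (2 q\<^sub>k)\<close>-separated, and at most \<open>4\<epsilon>q\<^sub>k + 1\<close> of them are within \<open>\<epsilon>\<close> of \<open>0\<close>
  (\<open>card_window_le\<close>).

  This gives both upper bounds. The range \<open>1, \<dots>, N\<close> is one window for \<open>q'\<close>, so
  \<open>card A \<le> 4\<epsilon>q' + 1\<close>, where the \<open>1\<close> is absorbed because \<open>2\<epsilon>q' > 2\<epsilon>N > 1\<close>. It is also
  covered by at most \<open>2N / q\<close> windows for \<open>q\<close>, so \<open>card A \<le> 8\<epsilon>N + 2N / q\<close>
  (\<open>card_le_blocks\<close>). Together they bound \<open>card A\<close> by \<open>12 M\<close>.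

  The lower bound has one argument for each term of the outer maximum in \<open>M\<close>. The multiples
  \<open>q, 2q, 3q, \<dots>\<close> satisfy \<open>\<parallel>jq\<alpha>\<parallel> < j / q'\<close>, so those with \<open>j \<le> \<epsilon>q'\<close> and \<open>jq \<le> N\<close> all lie
  in \<open>A\<close> (\<open>card_ge_multiples\<close>). The bound \<open>\<lfloor>\<epsilon>N\<rfloor>\<close> holds for every real \<open>\<alpha>\<close>: some arc of
  length \<open>\<epsilon>\<close> contains more than \<open>\<lfloor>\<epsilon>N\<rfloor>\<close> of the \<open>N + 1\<close> points \<open>0, \<alpha>, \<dots>, N\<alpha>\<close>, and the
  differences of their indices from the smallest one lie in \<open>A\<close> (\<open>card_ge_pigeonhole\<close>).
\<close>

section \<open>Approximation errors of the convergents\<close>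

definition cf_num :: "real \<Rightarrow> nat \<Rightarrow> int" where
  "cf_num x n = fst (cf_pair (cf_coeff x) n)"

definition cf_error :: "real \<Rightarrow> nat \<Rightarrow> real" where
  "cf_error x n = real (cf_denom x n) * x - of_int (cf_num x n)"

lemma cf_denom_pos:
  assumes "x \<notin> \<rat>"
  shows "cf_denom x n > 0"
  using cf_value_eq_pair[of "cf_coeff x" n, OF cf_coeff_pos[OF assms]]
  by (simp add: cf_denom_eq_pair[OF assms, symmetric])

lemma cf_denom_mono:
  assumes "x \<notin> \<rat>"
  shows "cf_denom x n \<le> cf_denom x (Suc n)"
proof (cases n)
  case 0
  then show ?thesis
    using cf_denom_pos[OF assms, of 1] by (simp add: cf_denom_0)
next
  case (Suc m)
  have "1 * int (cf_denom x (Suc m)) \<le> cf_coeff x (Suc (Suc m)) * int (cf_denom x (Suc m))"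
    using cf_coeff_pos[OF assms, of "Suc m"] by (intro mult_right_mono) auto
  then have "int (cf_denom x (Suc m)) \<le> int (cf_denom x (Suc (Suc m)))"
    using cf_denom_rec[OF assms, of m] by linarith
  then show ?thesis by (simp add: Suc)
qed

lemma cf_num_rec:
  "cf_num x (Suc (Suc n)) = cf_coeff x (Suc (Suc n)) * cf_num x (Suc n) + cf_num x n"
  by (simp add: cf_num_def cf_pair_rec del: cf_pair.simps)

lemma cf_error_rec:
  assumes "x \<notin> \<rat>"
  shows "cf_error x (Suc (Suc n)) =
    of_int (cf_coeff x (Suc (Suc n))) * cf_error x (Suc n) + cf_error x n"
proof -
  have "real (cf_denom x (Suc (Suc n))) =
      of_int (cf_coeff x (Suc (Suc n)) * int (cf_denom x (Suc n)) + int (cf_denom x n))"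
    by (metis cf_denom_rec[OF assms] of_int_of_nat_eq)
  then show ?thesis by (simp add: cf_error_def cf_num_rec algebra_simps)
qed

lemma cf_quotient_gt_1:
  assumes "x \<notin> \<rat>"
  shows "cf_quotient x (Suc n) > 1"
proof -
  have "cf_quotient x n \<notin> \<int>"
    using cf_quotient_irrational[OF assms, of n] Ints_subset_Rats by blast
  then show ?thesis by (simp add: frac_gt_0_iff frac_lt_1)
qed

lemma cf_coeff_eq_quotient:
  assumes "x \<notin> \<rat>"
  shows "of_int (cf_coeff x n) = cf_quotient x n - 1 / cf_quotient x (Suc n)"
  by (simp add: cf_coeff_def frac_def)

text \<open>
  Induction with the recurrence: the coefficient is the complete quotient \<open>x\<^bsub>n+2\<^esub>\<close> minus
  \<open>1 / x\<^bsub>n+3\<^esub>\<close>, and the term with \<open>x\<^bsub>n+2\<^esub>\<close> cancels the older error by the induction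
  hypothesis. Since complete quotients exceed 1, the errors alternate in sign and shrink.
\<close>

lemma cf_error_Suc:
  assumes "x \<notin> \<rat>"
  shows "cf_error x (Suc n) = - cf_error x n / cf_quotient x (Suc (Suc n))"
proof (induction n)
  case 0
  have e0: "cf_error x 0 = 1 / cf_quotient x 1"
    by (simp add: cf_error_def cf_denom_0 cf_num_def cf_coeff_def frac_def)
  have "real (cf_denom x 1) = of_int (cf_coeff x 1)"
    by (metis cf_denom_1[OF assms] of_int_of_nat_eq)
  then have "cf_error x 1 = of_int (cf_coeff x 1) * cf_error x 0 - 1"
    by (simp add: cf_error_def cf_denom_0 cf_num_def algebra_simps)
  also have "\<dots> = - cf_error x 0 / cf_quotient x 2"
    unfolding e0 cf_coeff_eq_quotient[OF assms] numeral_2_eq_2 One_nat_def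
    using cf_quotient_gt_1[OF assms, of 0] cf_quotient_gt_1[OF assms, of 1]
    by (simp add: field_simps del: cf_quotient.simps)
  finally show ?case by (simp add: numeral_2_eq_2 del: cf_quotient.simps)
next
  case (Suc n)
  have "cf_quotient x (Suc (Suc n)) > 1" by (rule cf_quotient_gt_1[OF assms])
  with Suc have "cf_error x n = - cf_quotient x (Suc (Suc n)) * cf_error x (Suc n)"
    by (simp add: field_simps del: cf_quotient.simps)
  then show ?case
    unfolding cf_error_rec[OF assms] cf_coeff_eq_quotient[OF assms]
    by (simp add: algebra_simps del: cf_quotient.simps)
qed

lemma cf_error_sign:
  assumes "x \<notin> \<rat>"
  shows "cf_error x n = (- 1) ^ n * \<bar>cf_error x n\<bar>"
proof (induction n)
  case 0
  show ?case by (simp add: cf_error_def cf_denom_0 cf_num_def cf_coeff_def)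
next
  case (Suc n)
  have "\<bar>cf_error x (Suc n)\<bar> = \<bar>cf_error x n\<bar> / cf_quotient x (Suc (Suc n))"
    unfolding cf_error_Suc[OF assms] using cf_quotient_gt_1[OF assms, of "Suc n"]
    by (simp add: abs_mult del: cf_quotient.simps)
  then show ?case
    by (subst cf_error_Suc[OF assms], subst Suc) (simp del: cf_quotient.simps)
qed

lemma cf_error_antimono:
  assumes "x \<notin> \<rat>"
  shows "\<bar>cf_error x (Suc n)\<bar> \<le> \<bar>cf_error x n\<bar>"
  unfolding cf_error_Suc[OF assms] using cf_quotient_gt_1[OF assms, of "Suc n"]
  by (simp add: divide_le_eq mult_le_cancel_left1 del: cf_quotient.simps)

lemma cf_det:
  assumes "x \<notin> \<rat>"
  shows "cf_num x (Suc n) * int (cf_denom x n) - cf_num x n * int (cf_denom x (Suc n)) = (- 1) ^ n"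
proof (induction n)
  case 0
  show ?case by (simp add: cf_denom_0 cf_num_def cf_denom_1[OF assms, simplified])
next
  case (Suc n)
  then show ?case
    by (simp add: cf_num_rec cf_denom_rec[OF assms] algebra_simps)
qed

text \<open>
  Eliminating \<open>x\<close> from two consecutive errors leaves the determinant of the convergents; as
  the errors have opposite signs, their absolute values add up in this combination.
\<close>

lemma cf_error_identity:
  assumes "x \<notin> \<rat>"
  shows "real (cf_denom x (Suc n)) * \<bar>cf_error x n\<bar> + real (cf_denom x n) * \<bar>cf_error x (Suc n)\<bar> = 1"
proof -
  have "(- 1) ^ n * (real (cf_denom x (Suc n)) * \<bar>cf_error x n\<bar>
          + real (cf_denom x n) * \<bar>cf_error x (Suc n)\<bar>)
      = real (cf_denom x (Suc n)) * cf_error x n - real (cf_denom x n) * cf_error x (Suc n)"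
    by (subst (2) cf_error_sign[OF assms], subst (3) cf_error_sign[OF assms])
       (simp add: algebra_simps)
  also have "\<dots> = of_int (cf_num x (Suc n) * int (cf_denom x n) - cf_num x n * int (cf_denom x (Suc n)))"
    by (simp add: cf_error_def algebra_simps)
  also have "\<dots> = (- 1) ^ n" by (simp add: cf_det[OF assms])
  finally show ?thesis by simp
qed

lemma cf_error_less:
  assumes "x \<notin> \<rat>"
  shows "\<bar>cf_error x n\<bar> < 1 / real (cf_denom x (Suc n))"
proof -
  have "cf_error x k \<noteq> 0" for k
  proof
    assume "cf_error x k = 0"
    then have "x = of_int (cf_num x k) / of_int (int (cf_denom x k))"
      using cf_denom_pos[OF assms, of k] by (simp add: cf_error_def field_simps)
    also have "\<dots> \<in> \<rat>" by (intro Rats_divide Rats_of_int)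
    finally show False using assms by simp
  qed
  then have "real (cf_denom x n) * \<bar>cf_error x (Suc n)\<bar> > 0"
    using cf_denom_pos[OF assms, of n] by simp
  then show ?thesis
    using cf_error_identity[OF assms, of n] cf_denom_pos[OF assms, of "Suc n"]
    by (simp add: field_simps)
qed

lemma cf_error_ge:
  assumes "x \<notin> \<rat>"
  shows "\<bar>cf_error x n\<bar> \<ge> 1 / (2 * real (cf_denom x (Suc n)))"
proof -
  have "1 \<le> real (cf_denom x (Suc n)) * \<bar>cf_error x n\<bar> + real (cf_denom x (Suc n)) * \<bar>cf_error x n\<bar>"
    unfolding cf_error_identity[OF assms, of n, symmetric]
    using cf_denom_mono[OF assms, of n] cf_error_antimono[OF assms, of n]
    by (intro add_mono mult_mono) auto
  then show ?thesis
    using cf_denom_pos[OF assms, of "Suc n"] by (simp add: field_simps)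
qed

text \<open>
  Two consecutive convergents form a basis of the integer lattice. If \<open>(n, m)\<close> has coordinates
  \<open>u\<close>, \<open>v\<close> in it, then \<open>0 < n < q\<^bsub>k+1\<^esub>\<close> excludes \<open>u = 0\<close> and \<open>u\<close>, \<open>v\<close> of the same sign.
  As the two errors have opposite signs, the contributions of \<open>u\<close> and \<open>v\<close> to \<open>n x - m\<close> do not
  cancel, and already the first has size at least the error of the \<open>k\<close>-th convergent.
\<close>

lemma best_approximation:
  fixes n m :: int
  assumes "x \<notin> \<rat>" "0 < n" "n < int (cf_denom x (Suc k))"
  shows "\<bar>cf_error x k\<bar> \<le> \<bar>of_int n * x - of_int m\<bar>"
proof -
  define p q p' q' s where "p = cf_num x k" and "q = int (cf_denom x k)"
    and "p' = cf_num x (Suc k)" and "q' = int (cf_denom x (Suc k))" and "s = (- 1 :: int) ^ k"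
  have pos: "q > 0" "q' > 0" using cf_denom_pos[OF assms(1)] by (simp_all add: q_def q'_def)
  have det: "p' * q - p * q' = s"
    using cf_det[OF assms(1), of k] by (simp add: p_def q_def p'_def q'_def s_def)
  have ss: "s * s = 1" by (simp add: s_def power_mult_distrib[symmetric])
  \<comment> \<open>Cramer's rule; the determinant is a sign, hence its own inverse.\<close>
  define u v where "u = s * (n * p' - m * q')" and "v = s * (m * q - n * p)"
  have "u * q + v * q' = s * (n * (p' * q - p * q'))"
    by (simp add: u_def v_def algebra_simps)
  then have n: "n = u * q + v * q'" using ss by (simp add: det)
  have "u * p + v * p' = s * (m * (p' * q - p * q'))"
    by (simp add: u_def v_def algebra_simps)
  then have m: "m = u * p + v * p'" using ss by (simp add: det)
  have "u \<noteq> 0"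
  proof
    assume "u = 0"
    then have "q' dvd n" using n by simp
    then show False using assms(2,3) zdvd_imp_le[of q' n] by (simp add: q'_def)
  qed
  have uv: "u * v \<le> 0"
  proof (rule ccontr)
    assume "\<not> u * v \<le> 0"
    then consider "u \<ge> 1" "v \<ge> 1" | "u \<le> - 1" "v \<le> - 1"
      by (auto simp: not_le zero_less_mult_iff)
    then show False
    proof cases
      case 1
      then have "u * q \<ge> 0" "v * q' \<ge> 1 * q'"
        using pos by (auto intro: mult_right_mono simp del: mult_1)
      then show False using n assms(3) by (simp add: q'_def)
    next
      case 2
      then have "u * q \<le> 0" "v * q' \<le> 0"
        using pos by (auto simp: mult_le_0_iff)
      then show False using n assms(2) by simp
    qed
  qed
  have "of_int n * x - of_int m = of_int u * cf_error x k + of_int v * cf_error x (Suc k)"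
    unfolding n m by (simp add: cf_error_def p_def q_def p'_def q'_def algebra_simps)
  also have "\<dots> = (- 1) ^ k * (of_int u * \<bar>cf_error x k\<bar> - of_int v * \<bar>cf_error x (Suc k)\<bar>)"
    by (subst (1) cf_error_sign[OF assms(1)], subst (2) cf_error_sign[OF assms(1)])
       (simp add: algebra_simps)
  finally have "\<bar>of_int n * x - of_int m\<bar>
      = \<bar>of_int u * \<bar>cf_error x k\<bar> - of_int v * \<bar>cf_error x (Suc k)\<bar>\<bar>"
    by (simp add: abs_mult)
  also have "\<dots> \<ge> \<bar>cf_error x k\<bar>"
  proof (cases "u > 0")
    case True
    then have "v \<le> 0" using uv by (simp add: mult_le_0_iff)
    then have "of_int v * \<bar>cf_error x (Suc k)\<bar> \<le> 0" by (simp add: mult_nonpos_nonneg)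
    moreover have "1 * \<bar>cf_error x k\<bar> \<le> of_int u * \<bar>cf_error x k\<bar>"
      using True by (intro mult_right_mono) auto
    ultimately show ?thesis by linarith
  next
    case False
    with \<open>u \<noteq> 0\<close> have u: "u \<le> - 1" by simp
    then have "v \<ge> 0" using uv by (simp add: mult_le_0_iff)
    then have "of_int v * \<bar>cf_error x (Suc k)\<bar> \<ge> 0" by simp
    moreover have "of_int u * \<bar>cf_error x k\<bar> \<le> (- 1) * \<bar>cf_error x k\<bar>"
      using u by (intro mult_right_mono) auto
    ultimately show ?thesis by linarith
  qed
  finally show ?thesis .
qed

lemma dist_int_ge_below_denom:
  assumes "x \<notin> \<rat>" "0 < n" "n < cf_denom x k"
  shows "1 / (2 * real (cf_denom x k)) \<le> dist_int (real n * x)"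
proof (cases k)
  case 0
  then show ?thesis using assms by (simp add: cf_denom_0)
next
  case (Suc j)
  show ?thesis
    using cf_error_ge[OF assms(1), of j]
      best_approximation[OF assms(1), of "int n" j "round (real n * x)"] assms(2,3)
    by (simp add: Suc dist_int_def)
qed

section \<open>Upper bounds by separation\<close>

text \<open>
  The interval of length \<open>2\<epsilon>\<close> that contains the values is cut into cells of length \<open>d\<close>;
  separation puts at most one value into each cell.
\<close>

lemma card_separated_le:
  fixes f :: "'a \<Rightarrow> real"
  assumes "finite A" "d > 0" "\<epsilon> \<ge> 0"
    and "\<And>a. a \<in> A \<Longrightarrow> \<bar>f a\<bar> < \<epsilon>"
    and "\<And>a b. \<lbrakk>a \<in> A; b \<in> A; a \<noteq> b\<rbrakk> \<Longrightarrow> d \<le> \<bar>f a - f b\<bar>"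
  shows "real (card A) \<le> 2 * \<epsilon> / d + 1"
proof -
  define g where "g a = \<lfloor>(f a + \<epsilon>) / d\<rfloor>" for a
  have "inj_on g A"
  proof (rule inj_onI, rule ccontr)
    fix a b assume ab: "a \<in> A" "b \<in> A" "g a = g b" "a \<noteq> b"
    have "\<bar>(f a + \<epsilon>) / d - (f b + \<epsilon>) / d\<bar> < 1"
      using ab(3) unfolding g_def by linarith
    moreover have "(f a + \<epsilon>) / d - (f b + \<epsilon>) / d = (f a - f b) / d"
      by (simp add: diff_divide_distrib[symmetric])
    ultimately have "\<bar>f a - f b\<bar> < d" using \<open>d > 0\<close> by simp
    then show False using assms(5)[OF ab(1,2,4)] by simp
  qed
  moreover have "g ` A \<subseteq> {0..\<lfloor>2 * \<epsilon> / d\<rfloor>}"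
  proof (rule image_subsetI)
    fix a assume "a \<in> A"
    then have "\<bar>f a\<bar> < \<epsilon>" by (rule assms(4))
    then have "0 \<le> (f a + \<epsilon>) / d" "(f a + \<epsilon>) / d \<le> 2 * \<epsilon> / d"
      using \<open>d > 0\<close> by (auto intro!: divide_right_mono)
    then show "g a \<in> {0..\<lfloor>2 * \<epsilon> / d\<rfloor>}" by (simp add: g_def floor_mono)
  qed
  ultimately have "card A \<le> card {0..\<lfloor>2 * \<epsilon> / d\<rfloor>}"
    by (intro card_inj_on_le) auto
  also have "\<dots> = nat (\<lfloor>2 * \<epsilon> / d\<rfloor> + 1)" by simp
  finally have "real (card A) \<le> of_int \<lfloor>2 * \<epsilon> / d\<rfloor> + 1"
    using assms(2,3) by (simp add: le_nat_iff)
  then show ?thesis by linarith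
qed

text \<open>
  The signed distances \<open>r n\<close> of \<open>n x\<close> to its nearest integer lie in an interval of length
  \<open>2\<epsilon>\<close>, and two of them differ by at least the distance of \<open>(b - a) x\<close> to the integers.
\<close>

lemma card_window_le:
  fixes A :: "nat set"
  assumes "x \<notin> \<rat>" "finite A" "\<epsilon> \<ge> 0"
    and "\<And>n. n \<in> A \<Longrightarrow> dist_int (real n * x) < \<epsilon>"
    and "\<And>a b. \<lbrakk>a \<in> A; b \<in> A\<rbrakk> \<Longrightarrow> b < a + cf_denom x k"
  shows "real (card A) \<le> 4 * \<epsilon> * real (cf_denom x k) + 1"
proof -
  define q where "q = cf_denom x k"
  define r where "r n = real n * x - of_int (round (real n * x))" for n
  have q: "q > 0" using cf_denom_pos[OF assms(1)] by (simp add: q_def)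
  have sep: "1 / (2 * real q) \<le> \<bar>r b - r a\<bar>" if "a \<in> A" "b \<in> A" "a < b" for a b
  proof -
    have "b - a < q" using assms(5)[OF that(1,2)] that(3) by (simp add: q_def)
    then have "1 / (2 * real q) \<le> dist_int (real (b - a) * x)"
      using dist_int_ge_below_denom[OF assms(1), of "b - a" k] that(3) by (simp add: q_def)
    also have "\<dots> \<le> \<bar>real (b - a) * x - of_int (round (real b * x) - round (real a * x))\<bar>"
      by (rule dist_int_le)
    also have "\<dots> = \<bar>r b - r a\<bar>"
      using that(3) by (simp add: r_def of_nat_diff algebra_simps)
    finally show ?thesis .
  qed
  have "real (card A) \<le> 2 * \<epsilon> / (1 / (2 * real q)) + 1"
  proof (rule card_separated_le[where f = r])
    show "1 / (2 * real q) \<le> \<bar>r a - r b\<bar>" if "a \<in> A" "b \<in> A" "a \<noteq> b" for a b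
      using sep[of a b] sep[of b a] that by (cases "a < b") (auto simp: abs_minus_commute)
  qed (use assms q in \<open>auto simp: r_def dist_int_def\<close>)
  then show ?thesis by (simp add: q_def)
qed

text \<open>
  The windows are the classes of equal quotient by \<open>q\<close>. There are \<open>N div q + 1\<close> of them, and
  \<open>q \<le> N\<close> allows the extra window to be absorbed into the factor 2.
\<close>

lemma card_le_blocks:
  assumes "x \<notin> \<rat>" "cf_denom x k \<le> N" "\<epsilon> \<ge> 0"
  shows "real (card {n. n \<ge> 1 \<and> dist_int (real n * x) < \<epsilon> \<and> n \<le> N})
    \<le> 8 * \<epsilon> * real N + 2 * real N / real (cf_denom x k)"
proof -
  define q where "q = cf_denom x k"
  define A where "A = {n. n \<ge> 1 \<and> dist_int (real n * x) < \<epsilon> \<and> n \<le> N}"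
  define B where "B b = {n \<in> A. n div q = b}" for b
  have q: "q > 0" using cf_denom_pos[OF assms(1)] by (simp add: q_def)
  have fin: "finite A" by (simp add: A_def)
  have B: "real (card (B b)) \<le> 4 * \<epsilon> * real q + 1" for b
    unfolding q_def
  proof (rule card_window_le[OF assms(1)])
    show "n' < n + cf_denom x k" if "n \<in> B b" "n' \<in> B b" for n n'
    proof -
      have "n' div q = n div q" using that by (simp add: B_def)
      then have "n' = q * (n div q) + n' mod q" "n = q * (n div q) + n mod q"
        by (metis mult_div_mod_eq) (simp only: mult_div_mod_eq)
      then show ?thesis using mod_less_divisor[OF q, of n'] unfolding q_def by linarith
    qed
  qed (use fin assms(3) in \<open>auto simp: B_def A_def\<close>)
  have "A \<subseteq> (\<Union>b\<in>{..N div q}. B b)"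
    by (auto simp: A_def B_def intro: div_le_mono)
  moreover have "finite (\<Union>b\<in>{..N div q}. B b)" using fin by (auto simp: B_def)
  ultimately have "card A \<le> (\<Sum>b\<le>N div q. card (B b))"
    using card_mono card_UN_le[of "{..N div q}" B] by (meson finite_atMost le_trans)
  then have "real (card A) \<le> (\<Sum>b\<le>N div q. real (card (B b)))"
    by (metis of_nat_le_iff of_nat_sum)
  also have "\<dots> \<le> real (card {..N div q}) * (4 * \<epsilon> * real q + 1)"
    by (rule sum_bounded_above) (rule B)
  also have "\<dots> \<le> (2 * real N / real q) * (4 * \<epsilon> * real q + 1)"
  proof (rule mult_right_mono)
    have "real (N div q) \<le> real N / real q" using q by (simp add: of_nat_div_le_of_nat)
    moreover have "1 \<le> real N / real q" using assms(2) q by (simp add: q_def)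
    ultimately show "real (card {..N div q}) \<le> 2 * real N / real q" by simp
  qed (use assms(3) in auto)
  also have "\<dots> = 8 * \<epsilon> * real N + 2 * real N / real q"
    using q by (simp add: field_simps)
  finally show ?thesis by (simp add: A_def q_def)
qed

section \<open>Lower bounds\<close>

lemma card_ge_multiples:
  assumes "x \<notin> \<rat>" "real j \<le> \<epsilon> * real (cf_denom x (Suc k))" "j * cf_denom x k \<le> N"
  shows "j \<le> card {n. n \<ge> 1 \<and> dist_int (real n * x) < \<epsilon> \<and> n \<le> N}" (is "_ \<le> card ?A")
proof -
  have q: "cf_denom x k > 0" "cf_denom x (Suc k) > 0" using cf_denom_pos[OF assms(1)] by auto
  have "(\<lambda>i. i * cf_denom x k) ` {1..j} \<subseteq> ?A"
  proof (rule image_subsetI)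
    fix i assume i: "i \<in> {1..j}"
    have "dist_int (real (i * cf_denom x k) * x)
        \<le> \<bar>real (i * cf_denom x k) * x - of_int (int i * cf_num x k)\<bar>" by (rule dist_int_le)
    also have "\<dots> = \<bar>real i * cf_error x k\<bar>" by (simp add: cf_error_def algebra_simps)
    also have "\<dots> < real i * (1 / real (cf_denom x (Suc k)))"
      unfolding abs_mult abs_of_nat using i cf_error_less[OF assms(1), of k]
      by (intro mult_strict_left_mono) auto
    also have "\<dots> \<le> \<epsilon>" using i assms(2) q by (simp add: field_simps)
    finally have "dist_int (real (i * cf_denom x k) * x) < \<epsilon>" .
    moreover have "i * cf_denom x k \<le> N"
      using assms(3) i by (meson atLeastAtMost_iff le_trans mult_le_mono1)
    ultimately show "i * cf_denom x k \<in> ?A" using i q by (auto simp: Suc_le_eq)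
  qed
  moreover have "inj_on (\<lambda>i. i * cf_denom x k) {1..j}" using q by (auto simp: inj_on_def)
  ultimately show ?thesis
    using card_inj_on_le[of "\<lambda>i. i * cf_denom x k" "{1..j}" ?A] by simp
qed

text \<open>
  This is a discrete form of the statement that the \<open>t\<close> with \<open>y\<close> in the arc \<open>[t, t + \<epsilon>)\<close> of
  the circle have measure \<open>\<epsilon>\<close>. Restricting \<open>t\<close> to the grid \<open>j / L\<close> costs at most one grid
  point; the integer \<open>z\<close> expresses membership in the arc modulo 1.
\<close>

lemma card_grid_arc_ge:
  fixes y \<epsilon> :: real
  assumes "0 < \<epsilon>" "\<epsilon> \<le> 1" "L > 0"
  shows "\<epsilon> * real L - 1 \<le>
    real (card {j \<in> {..<L}. \<exists>z::int. 0 \<le> y - real j / real L - of_int z \<and> y - real j / real L - of_int z < \<epsilon>})"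
    (is "_ \<le> real (card ?J)")
proof -
  define T where "T = nat \<lfloor>\<epsilon> * real L\<rfloor>"
  define c where "c = \<lfloor>y * real L\<rfloor>"
  \<comment> \<open>Starting at the last grid point not beyond \<open>y\<close>, walk backwards around the circle; \<open>T \<le> L\<close>
    ensures that no grid point is met twice.\<close>
  define g where "g i = nat ((c - int i) mod int L)" for i :: nat
  have T: "real T \<le> \<epsilon> * real L" "\<epsilon> * real L - 1 \<le> real T"
    using assms by (auto simp: T_def)
  have "\<epsilon> * real L \<le> real L" using assms by simp
  then have TL: "T \<le> L" using T by linarith
  have g: "int (g i) = (c - int i) mod int L" for i
    using assms(3) by (simp add: g_def)
  have "inj_on g {..<T}"
  proof (rule inj_onI)
    fix i i' assume i: "i \<in> {..<T}" "i' \<in> {..<T}" "g i = g i'"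
    then have "(c - int i) mod int L = (c - int i') mod int L" by (metis g)
    then have "int L dvd int i' - int i" by (simp add: mod_eq_dvd_iff)
    moreover have "\<bar>int i' - int i\<bar> < int L" using i TL by auto
    ultimately show "i = i'" using zdvd_imp_le[of "int L" "\<bar>int i' - int i\<bar>"] by auto
  qed
  moreover have "g ` {..<T} \<subseteq> ?J"
  proof (rule image_subsetI)
    fix i assume "i \<in> {..<T}"
    then have i: "real i + 1 \<le> \<epsilon> * real L" using T by simp
    define z where "z = (c - int i) div int L"
    have "c - int i = int L * z + int (g i)" by (simp add: z_def g)
    then have "of_int c - real i = real L * of_int z + real (g i)"
      by (metis of_int_add of_int_diff of_int_mult of_int_of_nat_eq)
    then have e: "real (g i) = of_int c - real i - real L * of_int z" by simp
    have eq: "y - real (g i) / real L - of_int z = (y * real L - of_int c + real i) / real L"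
      using assms(3) by (simp add: e field_simps)
    have "0 \<le> y * real L - of_int c" "y * real L - of_int c < 1"
      unfolding c_def by linarith+
    then have "0 \<le> y - real (g i) / real L - of_int z \<and> y - real (g i) / real L - of_int z < \<epsilon>"
      unfolding eq using i assms(3) by (simp add: field_simps)
    moreover have "g i < L" using assms(3) by (simp add: g_def nat_less_iff)
    ultimately show "g i \<in> ?J" by blast
  qed
  ultimately have "card {..<T} \<le> card ?J" by (intro card_inj_on_le) auto
  then show ?thesis using T by simp
qed

text \<open>
  If every arc of length \<open>\<epsilon>\<close> starting on the grid contained at most \<open>m = \<lfloor>\<epsilon>N\<rfloor>\<close> of the
  \<open>N + 1\<close> points, double counting would give \<open>(N + 1)(\<epsilon>L - 1) \<le> L m \<le> L \<epsilon> N\<close>, that is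
  \<open>\<epsilon>L \<le> N + 1\<close>, which fails on a fine enough grid. Points of a half-open arc
  of length \<open>\<epsilon>\<close> are less than \<open>\<epsilon>\<close> apart, so differences satisfy the strict inequality.
\<close>

lemma card_ge_pigeonhole:
  fixes x \<epsilon> :: real
  assumes "0 < \<epsilon>" "\<epsilon> \<le> 1"
  shows "\<lfloor>\<epsilon> * real N\<rfloor> \<le> int (card {n. n \<ge> 1 \<and> dist_int (real n * x) < \<epsilon> \<and> n \<le> N})"
    (is "_ \<le> int (card ?A)")
proof -
  define m where "m = nat \<lfloor>\<epsilon> * real N\<rfloor>"
  have m: "int m = \<lfloor>\<epsilon> * real N\<rfloor>" using assms by (simp add: m_def)
  then have m_le: "real m \<le> \<epsilon> * real N" by linarith
  define L where "L = Suc (nat \<lceil>(real N + 1) / \<epsilon>\<rceil>)"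
  have "(real N + 1) / \<epsilon> < real L" unfolding L_def by linarith
  then have L: "real N + 1 < \<epsilon> * real L" "L > 0"
    using assms by (auto simp: field_simps L_def)
  define R where "R n j \<longleftrightarrow> (\<exists>z::int. 0 \<le> real n * x - real j / real L - of_int z \<and>
      real n * x - real j / real L - of_int z < \<epsilon>)" for n j :: nat
  have "\<exists>j<L. m < card {n \<in> {..N}. R n j}"
  proof (rule ccontr)
    assume "\<not> ?thesis"
    then have le: "card {n \<in> {..N}. R n j} \<le> m" if "j < L" for j using that by (meson not_less)
    have "(real N + 1) * (\<epsilon> * real L - 1) = (\<Sum>n\<le>N. \<epsilon> * real L - 1)" by simp
    also have "\<dots> \<le> (\<Sum>n\<le>N. real (card {j \<in> {..<L}. R n j}))"
      unfolding R_def by (intro sum_mono card_grid_arc_ge assms L)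
    also have "\<dots> = real (\<Sum>n\<le>N. card {j \<in> {..<L}. R n j})" by simp
    also have "(\<Sum>n\<le>N. card {j \<in> {..<L}. R n j}) = (\<Sum>j<L. card {n \<in> {..N}. R n j})"
      by (rule sum_multicount_gen) auto
    also have "real \<dots> \<le> real (\<Sum>j<L. m)" using le by (intro of_nat_mono sum_mono) auto
    also have "\<dots> \<le> real L * (\<epsilon> * real N)" using m_le by (simp add: mult_left_mono)
    finally have "\<epsilon> * real L \<le> real N + 1" by (simp add: algebra_simps)
    then show False using L by simp
  qed
  then obtain j where j: "m < card {n \<in> {..N}. R n j}" by blast
  define B where "B = {n \<in> {..N}. R n j}"
  have fin: "finite B" by (simp add: B_def)
  have "B \<noteq> {}" using j unfolding B_def[symmetric] by auto
  define b where "b = Min B"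
  have b: "b \<in> B" "\<And>n. n \<in> B \<Longrightarrow> b \<le> n" using fin \<open>B \<noteq> {}\<close> by (auto simp: b_def)
  have "(\<lambda>n. n - b) ` (B - {b}) \<subseteq> ?A"
  proof (rule image_subsetI)
    fix n assume n: "n \<in> B - {b}"
    then have "b < n" using b(2)[of n] by auto
    from n obtain z :: int where z: "0 \<le> real n * x - real j / real L - of_int z"
      "real n * x - real j / real L - of_int z < \<epsilon>" by (auto simp: B_def R_def)
    from b(1) obtain w :: int where w: "0 \<le> real b * x - real j / real L - of_int w"
      "real b * x - real j / real L - of_int w < \<epsilon>" by (auto simp: B_def R_def)
    have "dist_int (real (n - b) * x) \<le> \<bar>real (n - b) * x - of_int (z - w)\<bar>" by (rule dist_int_le)
    also have "real (n - b) * x - of_int (z - w) = real n * x - of_int z - (real b * x - of_int w)"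
      using \<open>b < n\<close> by (simp add: of_nat_diff algebra_simps)
    also have "\<bar>\<dots>\<bar> < \<epsilon>" using z w by linarith
    finally show "n - b \<in> ?A" using \<open>b < n\<close> n by (auto simp: B_def)
  qed
  moreover have "inj_on (\<lambda>n. n - b) (B - {b})"
    using b(2) by (auto simp: inj_on_def) (metis eq_diff_iff)
  ultimately have "card (B - {b}) \<le> card ?A" by (intro card_inj_on_le) auto
  moreover have "card (B - {b}) = card B - 1" using b(1) fin by simp
  ultimately have "m \<le> card ?A" using j by (simp add: B_def)
  then show ?thesis by (simp flip: m)
qed

section \<open>The two-sided estimate\<close>

theorem lemma6p2:
  fixes \<alpha> \<epsilon> M :: real and N K :: nat
  assumes "\<alpha> \<notin> \<rat>"
    and "N \<ge> 1"
    and "\<epsilon> > 0"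
    and "1 / real N < 2 * \<epsilon>"
    and "2 * \<epsilon> < dist_int (real (cf_denom \<alpha> 2) * \<alpha>)"
    and "cf_denom \<alpha> K \<le> N"
    and "\<And>k. cf_denom \<alpha> k \<le> N \<Longrightarrow> k \<le> K"
    and "M = max (\<epsilon> * real N)
               (min (\<epsilon> * real (cf_denom \<alpha> (K + 1))) (real N / (2 * real (cf_denom \<alpha> K))))"
  shows "M = min (\<epsilon> * real (cf_denom \<alpha> (K + 1)))
               (max (\<epsilon> * real N) (real N / (2 * real (cf_denom \<alpha> K))))
    \<and> \<lfloor>M\<rfloor> \<le> int (card {n :: nat. n \<ge> 1 \<and> dist_int (real n * \<alpha>) < \<epsilon> \<and> n \<le> N})
    \<and> real (card {n :: nat. n \<ge> 1 \<and> dist_int (real n * \<alpha>) < \<epsilon> \<and> n \<le> N}) \<le> 32 * M"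
proof -
  define q q' where "q = cf_denom \<alpha> K" and "q' = cf_denom \<alpha> (K + 1)"
  define A where "A = {n :: nat. n \<ge> 1 \<and> dist_int (real n * \<alpha>) < \<epsilon> \<and> n \<le> N}"
  define t where "t = real N / (2 * real q)"
  have q: "q > 0" using cf_denom_pos[OF assms(1)] by (simp add: q_def)
  have Nq': "N < q'" using assms(7)[of "K + 1"] by (force simp: q'_def)
  then have le: "\<epsilon> * real N \<le> \<epsilon> * real q'" using assms(3) by simp
  have M: "M = max (\<epsilon> * real N) (min (\<epsilon> * real q') t)"
    using assms(8) by (simp add: q_def q'_def t_def)
  have M': "M = min (\<epsilon> * real q') (max (\<epsilon> * real N) t)" unfolding M using le by linarith
  have "dist_int (real (cf_denom \<alpha> 2) * \<alpha>) \<le> 1 / 2"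
    unfolding dist_int_def using of_int_round_abs_le[of "real (cf_denom \<alpha> 2) * \<alpha>"]
    by (simp add: abs_minus_commute)
  \<comment> \<open>Arcs of length \<open>\<epsilon>\<close> must not wrap around the circle in the pigeonhole argument.\<close>
  then have \<epsilon>1: "\<epsilon> \<le> 1" using assms(5) by linarith
  have lower: "\<lfloor>M\<rfloor> \<le> int (card A)"
  proof (cases "M = \<epsilon> * real N")
    case True
    then show ?thesis
      using card_ge_pigeonhole[OF assms(3) \<epsilon>1, of N \<alpha>] by (simp add: A_def)
  next
    case False
    then have min: "M \<le> \<epsilon> * real q'" "M \<le> t" using M by linarith+
    have "M \<ge> 0" using M assms(3) by (simp add: le_max_iff_disj)
    define j where "j = nat \<lfloor>M\<rfloor>"
    have j: "real j \<le> M" "int j = \<lfloor>M\<rfloor>" using \<open>M \<ge> 0\<close> by (auto simp: j_def)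
    \<comment> \<open>Up to \<open>N\<close> there are about \<open>N / q = 2t\<close> multiples of \<open>q\<close>, more than enough.\<close>
    have "real j \<le> real N / (2 * real q)" using j(1) min(2) by (simp add: t_def)
    then have "2 * (real j * real q) \<le> real N" using q by (simp add: field_simps)
    then have "real (j * q) \<le> real N" by simp
    then have "j \<le> card A"
      unfolding A_def using j(1) min(1)
      by (intro card_ge_multiples[OF assms(1), where k = K]) (simp_all add: q'_def q_def del: of_nat_mult)
    then show ?thesis using j(2) by simp
  qed
  have "real (card A) \<le> 4 * \<epsilon> * real q' + 1"
    unfolding q'_def
    by (rule card_window_le[OF assms(1)]) (use assms(3) Nq' in \<open>auto simp: A_def q'_def\<close>)
  moreover have "1 < 2 * (\<epsilon> * real N)" using assms(2,4) by (simp add: field_simps)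
  ultimately have up1: "real (card A) \<le> 6 * (\<epsilon> * real q')" using le by linarith
  have "real (card A) \<le> 8 * \<epsilon> * real N + 2 * real N / real q"
    unfolding A_def q_def using assms(1,3,6) by (intro card_le_blocks) auto
  also have "\<dots> = 8 * (\<epsilon> * real N) + 4 * t" by (simp add: t_def)
  finally have "real (card A) \<le> 8 * (\<epsilon> * real N) + 4 * t" .
  moreover have "t \<ge> 0" "\<epsilon> * real N \<ge> 0" using assms(3) by (auto simp: t_def)
  ultimately have "real (card A) \<le> 32 * M"
    unfolding M' using up1 by linarith
  then show ?thesis using lower M' by (simp add: A_def q_def q'_def t_def)
qed

end
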